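(* Let $A$ and $B$ be finite sets of UTVPI constraints with integer constants, such that $A\wedge B$ is satisfiable over $\mathbb Q$ but unsatisfiable over $\mathbb Z$. Let $A',B'$ be their difference-logic encodings and let $C$ be a cycle of total weight $0$ in the constraint graph $G(A'\wedge B')$ (each edge labelled as coming from $A'$ or from $B'$; write $C_A$, $C_B$ for the $A'$- and $B'$-edges of $C$) that contains, each exactly once, the two vertices $x_i^+$ and $x_i^-$ of some variable $x_i$, such that the weight of the path from $x_i^-$ to $x_i^+$ along $C$ is odd. Suppose $x_i$ occurs in both $A$ and $B$. Take the maximal $C_A$-paths of $C$, and split each of them at $x_i^+$ and at $x_i^-$ whenever that vertex is an interior vertex of the path (i.e. both its incoming and outgoing edges in $C$ belong to $C_A$), obtaining the two subpaths separated by that vertex. Let $I'$ be the conjunction of the summary constraints of the resulting paths and $I=\Upsilon(I')$. Then $I$ is an interpolant for $(A,B)$ over the integers.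
   Context: A UTVPI constraint is $(0\le a x + b y + k)$ with $a,b\in\{-1,0,1\}$. For each variable $x$ there are difference-logic variables $x^+,x^-$, with $\Upsilon(x^+)=x$, $\Upsilon(x^-)=-x$; write $v(x)=x^+$, $v(-x)=x^-$ for signed variables. Encoding: $(0\le s_1+s_2+k)$ with $s_1,s_2$ signed occurrences of distinct variables becomes $(0\le v(s_1)-v(-s_2)+k)$ and $(0\le v(s_2)-v(-s_1)+k)$; $(0\le s+k)$ becomes $(0\le v(s)-v(-s)+2k)$. $\Upsilon(0\le v-u+k)=(0\le\Upsilon(v)-\Upsilon(u)+k)$, extended to conjunctions. The graph has an edge $u\xrightarrow{c}v$ per constraint $(0\le v-u+c)$. A maximal $C_A$-path is a maximal path $u_1\xrightarrow{c_1}\cdots\xrightarrow{c_{n-1}}u_n$ of consecutive $C_A$-edges of $C$ preceded and followed in $C$ by $C_B$-edges; the summary constraint of a path $u_1\xrightarrow{c_1}\cdots\xrightarrow{c_{n-1}}u_n$ is $(0\le u_n-u_1+\sum c_j)$. An interpolant for $(A,B)$ over the integers is a formula $I$ with $A\models I$ and $I\wedge B$ unsatisfiable (variables ranging over $\mathbb Z$), and every variable of $I$ occurring in both $A$ and $B$.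
   Formalization: If every edge of C comes from A', no path is preceded and followed by B'-edges, so I would be the empty conjunction and the claim can fail; in that case the whole closed path C is taken as the maximal C_A-path and split at x_i^+ and x_i^-. *)

theory Defs
  imports Complex_Main
begin

(* Lin a x b y k is the constraint (0 <= a*x + b*y + k).  Sets of constraints are conjunctions. *)

datatype 'v lin = Lin int 'v int 'v int

fun is_utvpi :: "'v lin \<Rightarrow> bool" where
  "is_utvpi (Lin a x b y k) \<longleftrightarrow>
     a \<in> {-1, 0, 1} \<and> b \<in> {-1, 0, 1} \<and> (a \<noteq> 0 \<and> b \<noteq> 0 \<longrightarrow> x \<noteq> y)"

fun lin_vars :: "'v lin \<Rightarrow> 'v set" where
  "lin_vars (Lin a x b y k) = (if a = 0 then {} else {x}) \<union> (if b = 0 then {} else {y})"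

definition vars :: "'v lin set \<Rightarrow> 'v set" where
  "vars S = (\<Union>c\<in>S. lin_vars c)"

fun holds :: "('v \<Rightarrow> 'a::linordered_idom) \<Rightarrow> 'v lin \<Rightarrow> bool" where
  "holds \<sigma> (Lin a x b y k) \<longleftrightarrow> 0 \<le> of_int a * \<sigma> x + of_int b * \<sigma> y + of_int k"

definition models :: "('v \<Rightarrow> 'a::linordered_idom) \<Rightarrow> 'v lin set \<Rightarrow> bool" where
  "models \<sigma> S \<longleftrightarrow> (\<forall>c\<in>S. holds \<sigma> c)"

definition is_int_interpolant :: "'v lin set \<Rightarrow> 'v lin set \<Rightarrow> 'v lin set \<Rightarrow> bool" where
  "is_int_interpolant A B I \<longleftrightarrow>
     finite I \<and>
     (\<forall>\<sigma> :: 'v \<Rightarrow> int. models \<sigma> A \<longrightarrow> models \<sigma> I) \<and>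
     \<not> (\<exists>\<sigma> :: 'v \<Rightarrow> int. models \<sigma> (I \<union> B)) \<and>
     vars I \<subseteq> vars A \<inter> vars B"

datatype 'v svar = PosVar (svar_var: 'v) | NegVar (svar_var: 'v)

fun svar_neg :: "'v svar \<Rightarrow> 'v svar" where
  "svar_neg (PosVar x) = NegVar x"
| "svar_neg (NegVar x) = PosVar x"

fun svar_coeff :: "'v svar \<Rightarrow> int" where
  "svar_coeff (PosVar x) = 1"
| "svar_coeff (NegVar x) = -1"

definition signed :: "int \<Rightarrow> 'v \<Rightarrow> 'v svar" where
  "signed a x = (if a = 1 then PosVar x else NegVar x)"

(* VPlus x and VMinus x are the difference-logic variables x^+ and x^-. *)

datatype 'v dlvar = VPlus 'v | VMinus 'v

fun upsilon_var :: "'v dlvar \<Rightarrow> 'v svar" where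
  "upsilon_var (VPlus x) = PosVar x"
| "upsilon_var (VMinus x) = NegVar x"

fun dlvar_of :: "'v svar \<Rightarrow> 'v dlvar" where
  "dlvar_of (PosVar x) = VPlus x"
| "dlvar_of (NegVar x) = VMinus x"

(* Diff v u k is the difference constraint (0 <= v - u + k). *)

datatype 'w diff = Diff 'w 'w int

(* A variable-free constraint (0 <= k) yields no difference constraint; this loses nothing
   as long as the encoded set is satisfiable over the rationals. *)

fun encode :: "'v lin \<Rightarrow> 'v dlvar diff set" where
  "encode (Lin a x b y k) =
    (let s = signed a x; t = signed b y in
     if a \<noteq> 0 \<and> b \<noteq> 0 then
       {Diff (dlvar_of s) (dlvar_of (svar_neg t)) k,
        Diff (dlvar_of t) (dlvar_of (svar_neg s)) k}
     else if a \<noteq> 0 then {Diff (dlvar_of s) (dlvar_of (svar_neg s)) (2 * k)}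
     else if b \<noteq> 0 then {Diff (dlvar_of t) (dlvar_of (svar_neg t)) (2 * k)}
     else {})"

definition encoding :: "'v lin set \<Rightarrow> 'v dlvar diff set" where
  "encoding S = (\<Union>c\<in>S. encode c)"

(* The result is not UTVPI when v and u belong to the same variable, e.g. (0 <= x + x + k). *)

fun upsilon :: "'v dlvar diff \<Rightarrow> 'v lin" where
  "upsilon (Diff v u k) =
    (let s = upsilon_var v; t = upsilon_var u in
     Lin (svar_coeff s) (svar_var s) (- svar_coeff t) (svar_var t) k)"

datatype side = SideA | SideB

datatype 'w edge = Edge (src: 'w) (wt: int) (tgt: 'w) (side: side)

(* Labelled constraint graph: a constraint lying in both sets gives two parallel edges, so that a
   cycle may use it with either label. *)

definition constraint_graph :: "'w diff set \<Rightarrow> 'w diff set \<Rightarrow> 'w edge set" where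
  "constraint_graph A' B' =
     {Edge u c v SideA | u c v. Diff v u c \<in> A'} \<union> {Edge u c v SideB | u c v. Diff v u c \<in> B'}"

(* Cycles are closed walks; the edge after position length C - 1 is the one at position 0. *)

definition is_cycle :: "'w edge set \<Rightarrow> 'w edge list \<Rightarrow> bool" where
  "is_cycle G C \<longleftrightarrow> C \<noteq> [] \<and> set C \<subseteq> G \<and>
     (\<forall>j < length C. tgt (C ! j) = src (C ! (Suc j mod length C)))"

definition weight :: "'w edge list \<Rightarrow> int" where
  "weight p = sum_list (map wt p)"

definition arc :: "'w edge list \<Rightarrow> nat \<Rightarrow> nat \<Rightarrow> 'w edge list" where
  "arc C i l = map (\<lambda>j. C ! ((i + j) mod length C)) [0..<l]"

definition is_path_along :: "'w edge list \<Rightarrow> 'w \<Rightarrow> 'w \<Rightarrow> 'w edge list \<Rightarrow> bool" where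
  "is_path_along C u v p \<longleftrightarrow>
     (\<exists>i l. i < length C \<and> 1 \<le> l \<and> l \<le> length C \<and> p = arc C i l \<and>
            src (hd p) = u \<and> tgt (last p) = v)"

definition maximal_A_paths :: "'w edge list \<Rightarrow> 'w edge list set" where
  "maximal_A_paths C =
     {arc C i l | i l. i < length C \<and> 1 \<le> l \<and> l \<le> length C \<and>
        (\<forall>e \<in> set (arc C i l). side e = SideA) \<and>
        side (C ! ((i + length C - 1) mod length C)) = SideB \<and>
        side (C ! ((i + l) mod length C)) = SideB}"

(* If p visits w exactly once as an interior vertex, this is the pair of subpaths before and
   after w. *)

definition split_at :: "'w \<Rightarrow> 'w edge list \<Rightarrow> 'w edge list set" where
  "split_at w p =
     (if w \<in> src ` set (tl p)
      then \<Union>{{q, r} | q r. p = q @ r \<and> q \<noteq> [] \<and> r \<noteq> [] \<and> src (hd r) = w}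
      else {p})"

(* If C has no B-edge, no A-path is preceded and followed by a B-edge, and maximal_A_paths C is
   empty.  The maximal run of A-edges is then all of C, as a closed path with both w and w'
   interior; splitting it at w yields the path from w once around C back to w. *)

definition split_A_paths :: "'w \<Rightarrow> 'w \<Rightarrow> 'w edge list \<Rightarrow> 'w edge list set" where
  "split_A_paths w w' C =
     (let P = (if \<forall>e \<in> set C. side e = SideA
               then {arc C i (length C) | i. i < length C \<and> src (C ! i) = w}
               else maximal_A_paths C)
      in \<Union> (split_at w' ` \<Union> (split_at w ` P)))"

definition summary :: "'w edge list \<Rightarrow> 'w diff" where
  "summary p = Diff (tgt (last p)) (src (hd p)) (weight p)"

end

theory Submission
  imports Defs
begin

text \<open>
  An integer assignment \<sigma> gives the difference variables the values \<sigma> x for x^+ and -\<sigma> x for x^-.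
  If it satisfies I and B, then each of the two arcs of C between x^+ and x^- is a concatenation
  of B-edges and split A-paths, so its slack is nonnegative. Since C has weight 0 the two slacks
  are opposite, hence both vanish, and the arc from x^- to x^+ has the even weight -2 \<sigma> x.
  The splitting ensures that no A-path straddles the two arcs.
\<close>

section \<open>Integer valuations of the difference variables and soundness of the encoding\<close>

definition dl_val :: "('v \<Rightarrow> int) \<Rightarrow> 'v dlvar \<Rightarrow> int" where
  "dl_val \<sigma> v = svar_coeff (upsilon_var v) * \<sigma> (svar_var (upsilon_var v))"

abbreviation dl_var :: "'v dlvar \<Rightarrow> 'v" where
  "dl_var v \<equiv> svar_var (upsilon_var v)"

lemma dl_val_simps [simp]: "dl_val \<sigma> (VPlus x) = \<sigma> x" "dl_val \<sigma> (VMinus x) = - \<sigma> x"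
  by (simp_all add: dl_val_def)

lemma holds_upsilon:
  fixes \<sigma> :: "'v \<Rightarrow> int"
  shows "holds \<sigma> (upsilon (Diff v u k)) \<longleftrightarrow> 0 \<le> dl_val \<sigma> v - dl_val \<sigma> u + k"
  by (simp add: Let_def dl_val_def)

lemma lin_vars_upsilon: "lin_vars (upsilon (Diff v u k)) = {dl_var v, dl_var u}"
  by (cases v; cases u) auto

text \<open>Under \<open>dl_val\<close> both difference constraints of a two-variable constraint
  read as the constraint itself, and that of a one-variable constraint as its double, hence the
  constant \<open>2 * k\<close>. As \<open>signed\<close> sends every coefficient but 1 to
  \<open>NegVar\<close>, the coefficient range in \<open>is_utvpi\<close> is what excludes wrong
  signs.\<close>

lemma encode_sound:
  fixes \<sigma> :: "'v \<Rightarrow> int"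
  assumes "is_utvpi c" "holds \<sigma> c" "Diff v u k \<in> encode c"
  shows "0 \<le> dl_val \<sigma> v - dl_val \<sigma> u + k"
  using assms by (cases c) (auto simp: Let_def signed_def split: if_splits)

lemma encode_vars: "Diff v u k \<in> encode c \<Longrightarrow> dl_var v \<in> lin_vars c \<and> dl_var u \<in> lin_vars c"
  by (cases c) (auto simp: Let_def signed_def split: if_splits)

text \<open>Nonnegative exactly when the constraint behind the edge is true. Slacks telescope along
  a path, which links single edges to summary constraints.\<close>

definition slack :: "('v \<Rightarrow> int) \<Rightarrow> 'v dlvar edge \<Rightarrow> int" where
  "slack \<sigma> e = dl_val \<sigma> (tgt e) - dl_val \<sigma> (src e) + wt e"

lemma graph_edge_sound:
  fixes \<sigma> :: "'v \<Rightarrow> int"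
  assumes "\<forall>c \<in> A \<union> B. is_utvpi c" "e \<in> constraint_graph (encoding A) (encoding B)"
    and "models \<sigma> (case side e of SideA \<Rightarrow> A | SideB \<Rightarrow> B)"
  shows "0 \<le> slack \<sigma> e"
  using assms
  by (auto simp: constraint_graph_def encoding_def models_def slack_def intro: encode_sound)

lemma graph_edge_vars:
  assumes "e \<in> constraint_graph (encoding A) (encoding B)"
  defines "S \<equiv> (case side e of SideA \<Rightarrow> A | SideB \<Rightarrow> B)"
  shows "dl_var (src e) \<in> vars S" "dl_var (tgt e) \<in> vars S"
  using assms(1) unfolding S_def
  by (auto simp: constraint_graph_def encoding_def vars_def dest!: encode_vars)

lemma weight_append [simp]: "weight (p @ q) = weight p + weight q"
  by (simp add: weight_def)

section \<open>Cutting a list of edges at one or two vertices\<close>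

lemma split_at_factor:
  assumes "s \<in> split_at w p" "p \<noteq> []"
  shows "\<exists>L R. p = L @ s @ R \<and> s \<noteq> [] \<and> (L \<noteq> [] \<longrightarrow> src (hd s) = w) \<and> (R \<noteq> [] \<longrightarrow> src (hd R) = w)"
proof (cases "w \<in> src ` set (tl p)")
  case True
  then obtain q r where "p = q @ r" "q \<noteq> []" "r \<noteq> []" "src (hd r) = w" "s = q \<or> s = r"
    using assms by (auto simp: split_at_def)
  then have "p = [] @ s @ r \<and> s = q \<or> p = q @ s @ [] \<and> s = r" by auto
  then show ?thesis
    using \<open>q \<noteq> []\<close> \<open>r \<noteq> []\<close> \<open>src (hd r) = w\<close> by blast
next
  case False
  then have "p = [] @ s @ []" using assms by (simp add: split_at_def)
  then show ?thesis using assms by blast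
qed

lemma finite_split_at: "finite (split_at w p)"
proof -
  have "split_at w p \<subseteq> insert p ((\<lambda>i. take i p) ` {..length p} \<union> (\<lambda>i. drop i p) ` {..length p})"
  proof
    fix s assume s: "s \<in> split_at w p"
    have "s = p \<or> (\<exists>q r. p = q @ r \<and> (s = q \<or> s = r))"
      using s by (auto simp: split_at_def split: if_splits)
    then consider "s = p" | q r where "p = q @ r" "s = q \<or> s = r" by blast
    then show "s \<in> insert p ((\<lambda>i. take i p) ` {..length p} \<union> (\<lambda>i. drop i p) ` {..length p})"
    proof cases
      case (2 q r)
      then have "s = take (length q) p \<or> s = drop (length q) p" "length q \<le> length p" by auto
      then show ?thesis by blast
    qed simp
  qed
  then show ?thesis by (rule finite_subset) simp
qed

text \<open>The only possible cut misses the interior of \<open>s\<close>, so \<open>s\<close>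
  survives whole in one piece. \<open>L'\<close> and \<open>R'\<close> are the remains of its
  context there; a cut exactly at an end of \<open>s\<close> leaves nothing on that side.\<close>

lemma split_at_keeps_factor:
  assumes "p = L @ s @ R" "s \<noteq> []" "w \<notin> src ` set (tl s)" "count_list (map src p) w \<le> 1"
  shows "\<exists>L' R'. L' @ s @ R' \<in> split_at w p
    \<and> (\<exists>L0. L = L0 @ L') \<and> (\<exists>R0. R = R' @ R0)
    \<and> (L' \<noteq> [] \<longrightarrow> src (hd s) \<noteq> w) \<and> (R' \<noteq> [] \<longrightarrow> src (hd R') \<noteq> w)"
proof (cases "w \<in> src ` set (tl p)")
  case False
  then have "L @ s @ R \<in> split_at w p" using assms by (simp add: split_at_def)
  moreover have "src (hd s) \<noteq> w" if "L \<noteq> []"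
    using that False assms by (cases s) auto
  moreover have "src (hd R) \<noteq> w" if "R \<noteq> []"
  proof -
    have "tl p = tl (L @ s) @ R" using assms(1,2) by (cases L; cases s) auto
    then have "hd R \<in> set (tl p)" using that by simp
    then show ?thesis using False by auto
  qed
  ultimately show ?thesis by (metis append_Nil append_Nil2)
next
  case True
  then obtain e where e: "e \<in> set (tl p)" "src e = w" by auto
  then obtain q0 r where "tl p = q0 @ e # r" by (meson split_list)
  moreover have "p = hd p # tl p" using assms(1,2) by simp
  ultimately obtain q where p: "p = q @ e # r" "q \<noteq> []"
    by (metis append_Cons list.discI)
  \<comment> \<open>Since \<open>w\<close> is visited at most once, \<open>e\<close> is the only
    edge leaving it and the cut before \<open>e\<close> is the only one.\<close>
  have cnt: "w \<notin> src ` set q" "w \<notin> src ` set r"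
    using assms(4) e(2) unfolding p(1) by (auto simp: count_list_0_iff)
  have "{q, e # r} \<in> {{q, r} | q r. p = q @ r \<and> q \<noteq> [] \<and> r \<noteq> [] \<and> src (hd r) = w}"
    unfolding mem_Collect_eq by (rule exI[of _ q], rule exI[of _ "e # r"]) (simp add: p e(2))
  then have mem: "q \<in> split_at w p" "e # r \<in> split_at w p"
    unfolding split_at_def if_P[OF True] by blast+
  \<comment> \<open>The cut lies at or before the start of \<open>s\<close>, at or after its end, or
    strictly inside; the last case contradicts the assumption on \<open>tl s\<close>.\<close>
  consider L' where "L = q @ L'" "e # r = L' @ s @ R"
    | R' where "q = L @ s @ R'" "R = R' @ e # r"
    | t u where "s = t @ e # u" "t \<noteq> []"
  proof -
    have eq: "L @ s @ R = q @ e # r" using p assms by simp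
    then consider us where "L = q @ us" "us @ s @ R = e # r"
      | us where "L @ us = q" "s @ R = us @ e # r"
      by (auto simp: append_eq_append_conv2[of L])
    then show thesis
    proof cases
      case 1 then show thesis using that(1) by metis
    next
      case (2 us)
      from 2(2) consider vs where "s = us @ vs" "vs @ R = e # r"
        | vs where "s @ vs = us" "R = vs @ e # r"
        by (auto simp: append_eq_append_conv2[of s])
      then show thesis
      proof cases
        case (1 vs)
        show thesis
        proof (cases vs)
          case Nil
          then show thesis using that(2)[of "[]"] 1 2 by simp
        next
          case (Cons a u)
          then have "s = us @ e # u" using 1 by simp
          moreover have "L = q @ []" "e # r = [] @ s @ R" if "us = []"
            using 2 that by auto
          ultimately show thesis using that(1)[of "[]"] that(3)[of us u] by blast
        qed
      next
        case (2 vs)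
        then show thesis using that(2)[of vs] \<open>L @ us = q\<close> by simp
      qed
    qed
  qed
  then show ?thesis
  proof cases
    case (1 L')
    have "src (hd s) \<noteq> w" if "L' \<noteq> []"
      using 1 that cnt assms(2) by (cases L'; cases s) auto
    moreover have "src (hd R) \<noteq> w" if "R \<noteq> []"
      using 1 that cnt assms(2) by (cases "L' @ s"; cases R) (auto simp: append_eq_Cons_conv Cons_eq_append_conv)
    ultimately show ?thesis using 1 mem by (metis append_Nil2)
  next
    case (2 R')
    have "src (hd s) \<noteq> w" using 2 cnt assms(2) by (cases s) auto
    moreover have "src (hd R') \<noteq> w" if "R' \<noteq> []" using 2 that cnt by (cases R') auto
    ultimately show ?thesis using 2 mem by (metis append_Nil)
  next
    case (3 t u)
    then have "e \<in> set (tl s)" by (cases t) auto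
    then show ?thesis using assms(3) e by blast
  qed
qed

text \<open>Each end of a piece is either inherited from \<open>p\<close> or created by one of the
  two cuts, and then sits at a marked vertex.\<close>

lemma split_twice_factor:
  assumes "s \<in> \<Union> (split_at w' ` split_at w p)" "p \<noteq> []"
  shows "\<exists>L R. p = L @ s @ R \<and> s \<noteq> [] \<and> (L \<noteq> [] \<longrightarrow> src (hd s) \<in> {w, w'})
    \<and> (R \<noteq> [] \<longrightarrow> src (hd R) \<in> {w, w'})"
proof -
  obtain t where t: "t \<in> split_at w p" "s \<in> split_at w' t" using assms by auto
  obtain L R where LR: "p = L @ t @ R" "t \<noteq> []" "L \<noteq> [] \<longrightarrow> src (hd t) = w"
    "R \<noteq> [] \<longrightarrow> src (hd R) = w" using split_at_factor[OF t(1) assms(2)] by blast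
  obtain L' R' where LR': "t = L' @ s @ R'" "s \<noteq> []" "L' \<noteq> [] \<longrightarrow> src (hd s) = w'"
    "R' \<noteq> [] \<longrightarrow> src (hd R') = w'" using split_at_factor[OF t(2) LR(2)] by blast
  have "p = (L @ L') @ s @ (R' @ R)" using LR LR' by simp
  moreover have "src (hd s) \<in> {w, w'}" if "L @ L' \<noteq> []"
    using that LR LR' by (cases "L' = []") (auto simp: hd_append)
  moreover have "src (hd (R' @ R)) \<in> {w, w'}" if "R' @ R \<noteq> []"
    using that LR LR' by (cases "R' = []") (auto simp: hd_append)
  ultimately show ?thesis using LR'(2) by blast
qed

text \<open>Converse of \<open>split_twice_factor\<close>: a factor with no marked vertex inside,
  whose ends are ends of \<open>p\<close> or marked, is exactly one of the pieces.\<close>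

lemma factor_in_split_twice:
  assumes "p = L @ s @ R" "s \<noteq> []" "{w, w'} \<inter> src ` set (tl s) = {}"
    and "count_list (map src p) w \<le> 1" "count_list (map src p) w' \<le> 1"
    and "L \<noteq> [] \<longrightarrow> src (hd s) \<in> {w, w'}" "R \<noteq> [] \<longrightarrow> src (hd R) \<in> {w, w'}"
  shows "s \<in> \<Union> (split_at w' ` split_at w p)"
proof -
  obtain L1 R1 L0 R0 where 1: "L1 @ s @ R1 \<in> split_at w p" "L = L0 @ L1" "R = R1 @ R0"
    "L1 \<noteq> [] \<longrightarrow> src (hd s) \<noteq> w" "R1 \<noteq> [] \<longrightarrow> src (hd R1) \<noteq> w"
    using split_at_keeps_factor[OF assms(1,2) _ assms(4)] assms(3) by blast
  have cnt: "count_list (map src (L1 @ s @ R1)) w' \<le> 1"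
    using assms(1,5) 1 by simp
  obtain L2 R2 L0' R0' where 2: "L2 @ s @ R2 \<in> split_at w' (L1 @ s @ R1)"
    "L1 = L0' @ L2" "R1 = R2 @ R0'"
    "L2 \<noteq> [] \<longrightarrow> src (hd s) \<noteq> w'" "R2 \<noteq> [] \<longrightarrow> src (hd R2) \<noteq> w'"
    using split_at_keeps_factor[OF refl assms(2) _ cnt] assms(3) by blast
  \<comment> \<open>Context left over after both cuts would begin \<open>s\<close>, or follow it, at
    a vertex that is neither \<open>w\<close> nor \<open>w'\<close>, against the assumption on the
    ends.\<close>
  have "L2 = []" using 1 2 assms(6) by auto
  moreover have "R2 = []" using 1 2 assms(7) by (cases R2) auto
  ultimately show ?thesis using 1(1) 2(1) by auto
qed

lemma last_before:
  fixes a i :: nat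
  assumes "a \<le> i" "Q a"
  shows "\<exists>a\<le>i. Q a \<and> (\<forall>b. a < b \<and> b \<le> i \<longrightarrow> \<not> Q b)"
proof -
  define g where "g = Greatest (\<lambda>a. a \<le> i \<and> Q a)"
  have "g \<le> i \<and> Q g"
    unfolding g_def by (rule GreatestI_nat[of _ a i]) (use assms in auto)
  moreover have "b \<le> g" if "b \<le> i" "Q b" for b
    unfolding g_def by (rule Greatest_le_nat[of _ b i]) (use that in auto)
  ultimately show ?thesis by (auto dest: leD)
qed

section \<open>Periodic indexing of a cycle that visits two marked vertices once each\<close>

locale marked_cycle =
  fixes C :: "'w edge list" and w w' :: 'w
  assumes nonempty: "C \<noteq> []"
    and linked: "\<And>j. j < length C \<Longrightarrow> tgt (C ! j) = src (C ! (Suc j mod length C))"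
    and once: "count_list (map src C) w = 1" "count_list (map src C) w' = 1"
begin

abbreviation n :: nat where "n \<equiv> length C"

text \<open>Unrolls the cycle into a periodic sequence, so that arcs become index intervals and
  wrapping around needs no case distinction.\<close>

definition cyc :: "nat \<Rightarrow> 'w edge" where "cyc j = C ! (j mod n)"

text \<open>The positions where a summary path may begin or end: marked vertices and end points of
  B-edges. The preceding edge has index \<open>j + n - 1\<close> because \<open>j - 1\<close> would
  be truncated at 0.\<close>

definition breakpoint :: "nat \<Rightarrow> bool" where
  "breakpoint j \<longleftrightarrow> src (cyc j) \<in> {w, w'} \<or> side (cyc j) = SideB \<or> side (cyc (j + n - 1)) = SideB"

lemma n_pos: "0 < n"
  using nonempty by simp

lemma cyc_in: "cyc j \<in> set C"
  unfolding cyc_def using n_pos by (intro nth_mem) simp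

lemma cyc_add [simp]: "cyc (j + n) = cyc j"
  by (simp add: cyc_def)

lemma breakpoint_add [simp]: "breakpoint (j + n) \<longleftrightarrow> breakpoint j"
proof -
  have "j + n + n - 1 = (j + n - 1) + n" using n_pos by simp
  then show ?thesis unfolding breakpoint_def by (metis cyc_add)
qed

lemma breakpoint_Suc: "breakpoint (Suc j) \<longleftrightarrow>
    src (cyc (Suc j)) \<in> {w, w'} \<or> side (cyc (Suc j)) = SideB \<or> side (cyc j) = SideB"
  by (simp add: breakpoint_def)

lemma tgt_cyc: "tgt (cyc j) = src (cyc (Suc j))"
  using linked[of "j mod n"] n_pos by (simp add: cyc_def mod_Suc_eq)

lemma arc_eq: "arc C i l = map cyc [i..<i + l]"
  by (rule nth_equalityI) (simp_all add: arc_def cyc_def)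

lemma arc_add: "arc C i (l + m) = arc C i l @ arc C (i + l) m"
  using upt_add_eq_append[of i "i + l" m] by (simp add: arc_eq add.assoc)

lemma arc_mod: "arc C (i mod n) l = arc C i l"
  by (simp add: arc_def mod_add_left_eq)

lemma length_arc [simp]: "length (arc C i l) = l"
  by (simp add: arc_def)

lemma arc_eq_Nil [simp]: "arc C i l = [] \<longleftrightarrow> l = 0"
  by (simp add: arc_def)

lemma set_arc: "set (arc C i l) = cyc ` {i..<i + l}"
  by (simp add: arc_eq)

lemma hd_arc: "0 < l \<Longrightarrow> hd (arc C i l) = cyc i"
  by (simp add: arc_eq hd_map)

lemma last_arc: "0 < l \<Longrightarrow> last (arc C i l) = cyc (i + l - 1)"
  by (simp add: arc_eq last_map)

lemma tgt_last_arc: "0 < l \<Longrightarrow> tgt (last (arc C i l)) = src (cyc (i + l))"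
  by (simp add: last_arc tgt_cyc)

lemma tl_arc: "tl (arc C i l) = arc C (Suc i) (l - 1)"
  by (cases l) (simp_all add: arc_eq map_tl[symmetric] del: upt_Suc)

lemma arc_factor:
  assumes "arc C i l = L @ s @ R"
  shows "s = arc C (i + length L) (length s)"
    and "R = arc C (i + length L + length s) (length R)"
proof -
  have "l = length L + length s + length R" using arg_cong[OF assms, of length] by simp
  then have "L @ s @ R = arc C i (length L) @ arc C (i + length L) (length s)
      @ arc C (i + length L + length s) (length R)"
    using assms by (simp add: arc_add add.assoc)
  then show "s = arc C (i + length L) (length s)"
    "R = arc C (i + length L + length s) (length R)"
    by simp_all
qed

lemma arc_full: "arc C i n = rotate i C"
  by (rule nth_equalityI) (simp_all add: arc_def nth_rotate)

text \<open>An arc of at most one turn is a prefix of a rotation of \<open>C\<close>, and rotation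
  preserves counts.\<close>

lemma count_arc_le:
  assumes "l \<le> n"
  shows "count_list (map src (arc C i l)) v \<le> count_list (map src C) v"
proof -
  have "count_list (map src (arc C i l)) v \<le> count_list (map src (arc C i n)) v"
    using arc_add[of i l "n - l"] assms by simp
  also have "\<dots> = count_list (map src (drop (i mod n) C)) v + count_list (map src (take (i mod n) C)) v"
    by (simp add: arc_full rotate_drop_take)
  also have "\<dots> = count_list (map src (take (i mod n) C @ drop (i mod n) C)) v"
    unfolding map_append count_list_append by simp
  finally show ?thesis by simp
qed

lemma weight_arc_full: "weight (arc C i n) = weight C"
proof -
  have "weight (arc C i n) = weight (take (i mod n) C @ drop (i mod n) C)"
    unfolding weight_append by (simp add: arc_full rotate_drop_take)
  then show ?thesis by simp
qed

section \<open>The A-paths before and after splitting, located by their breakpoints\<close>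

definition base_paths :: "'w edge list set" where
  "base_paths = (if \<forall>e \<in> set C. side e = SideA
     then {arc C i n | i. i < n \<and> src (C ! i) = w} else maximal_A_paths C)"

lemma split_A_paths_eq: "split_A_paths w w' C = (\<Union>M\<in>base_paths. \<Union> (split_at w' ` split_at w M))"
  by (auto simp: split_A_paths_def base_paths_def Let_def)

text \<open>A maximal A-path is bordered by B-edges; in a cycle without B-edges the single turn
  starts and ends at \<open>w\<close>. Either way both ends are breakpoints.\<close>

lemma base_pathsE:
  assumes "M \<in> base_paths"
  obtains i l where "M = arc C i l" "0 < l" "l \<le> n" "breakpoint i" "breakpoint (i + l)"
    "\<forall>e \<in> set M. side e = SideA"
proof (cases "\<forall>e \<in> set C. side e = SideA")
  case True
  then obtain i where i: "M = arc C i n" "i < n" "src (C ! i) = w"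
    using assms by (auto simp: base_paths_def)
  then have "breakpoint i" by (simp add: breakpoint_def cyc_def)
  moreover have "\<forall>e \<in> set M. side e = SideA" using True i cyc_in by (auto simp: set_arc)
  ultimately show thesis using that[of i n] i n_pos by simp
next
  case False
  then obtain i l where il: "i < n" "1 \<le> l" "l \<le> n" "M = arc C i l" "\<forall>e \<in> set M. side e = SideA"
    "side (cyc (i + n - 1)) = SideB" "side (cyc (i + l)) = SideB"
    using assms unfolding base_paths_def maximal_A_paths_def cyc_def if_not_P[OF False] by auto
  then show thesis using that[of i l] by (simp add: breakpoint_def)
qed

lemma finite_split_A_paths: "finite (split_A_paths w w' C)"
proof -
  have "base_paths \<subseteq> (\<lambda>(i, l). arc C i l) ` ({..<n} \<times> {..n})"
    by (auto simp: base_paths_def maximal_A_paths_def)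
  then have "finite base_paths" by (rule finite_subset) simp
  then show ?thesis by (simp add: split_A_paths_eq finite_split_at)
qed

text \<open>Ends come from a base path or from a cut at a marked vertex. This form serves both the
  entailment from \<open>A\<close> and the condition on shared variables.\<close>

lemma split_A_pathsE:
  assumes "s \<in> split_A_paths w w' C"
  obtains i l where "s = arc C i l" "0 < l" "breakpoint i" "breakpoint (i + l)"
    "\<forall>e \<in> set s. side e = SideA"
proof -
  obtain M where M: "M \<in> base_paths" "s \<in> \<Union> (split_at w' ` split_at w M)"
    using assms by (auto simp: split_A_paths_eq)
  obtain i l where il: "M = arc C i l" "0 < l" "breakpoint i" "breakpoint (i + l)"
    "\<forall>e \<in> set M. side e = SideA" using base_pathsE[OF M(1)] by metis
  have "M \<noteq> []" using il by simp
  from split_twice_factor[OF M(2) this]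
  obtain L R where LR: "M = L @ s @ R" "s \<noteq> []" "L \<noteq> [] \<longrightarrow> src (hd s) \<in> {w, w'}"
    "R \<noteq> [] \<longrightarrow> src (hd R) \<in> {w, w'}" by blast
  let ?i = "i + length L" and ?m = "length s"
  have s: "s = arc C ?i ?m" and R: "R = arc C (?i + ?m) (length R)"
    using arc_factor[of i l L s R] il LR by auto
  have m: "0 < ?m" using LR by simp
  have "breakpoint ?i"
  proof (cases "L = []")
    case False
    then show ?thesis using LR s hd_arc[OF m, of ?i] by (simp add: breakpoint_def)
  qed (use il in simp)
  moreover have "breakpoint (?i + ?m)"
  proof (cases "R = []")
    case True
    then have "length M = length L + length s" using LR(1) by simp
    then show ?thesis using il(1,4) by (simp add: add.assoc)
  next
    case False
    then show ?thesis using LR R hd_arc[of "length R" "?i + ?m"] by (simp add: breakpoint_def)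
  qed
  ultimately show thesis using that[OF s m] il(5) LR(1) by simp
qed

text \<open>Without breakpoints inside, the stretch consists of A-edges and meets no marked vertex
  in its interior, so it lies in one base path and no cut goes through it. The bound
  \<open>n \<le> i\<close> leaves a full turn to the left of \<open>i\<close> in which to find the
  start of that base path.\<close>

lemma breakpoint_gap_in_split_A_paths:
  assumes i: "n \<le> i" and m: "0 < m" "breakpoint i" "breakpoint (i + m)"
    and inner: "\<And>j. i < j \<Longrightarrow> j < i + m \<Longrightarrow> \<not> breakpoint j"
    and A: "side (cyc i) = SideA"
  shows "arc C i m \<in> split_A_paths w w' C"
proof -
  let ?s = "arc C i m"
  have A': "side (cyc j) = SideA" if "i \<le> j" "j < i + m" for j
    using inner[of j] that A by (cases "j = i") (auto simp: breakpoint_def intro: side.exhaust)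
  \<comment> \<open>It suffices to enclose the stretch in a base path. Where that path extends
    beyond an end, the edges on both sides are A-edges, so the breakpoint there must be a marked
    vertex.\<close>
  have key: "?s \<in> split_A_paths w w' C"
    if M: "arc C a l \<in> base_paths" "a \<le> i" "i + m \<le> a + l" "l \<le> n" for a l
  proof -
    have all_A: "side (cyc j) = SideA" if "a \<le> j" "j < a + l" for j
      using base_pathsE[OF M(1)] that by (metis set_arc atLeastLessThan_iff imageI)
    let ?L = "arc C a (i - a)" and ?R = "arc C (i + m) (a + l - (i + m))"
    have "l = (i - a) + (m + (a + l - (i + m)))" using M by simp
    then have M_eq: "arc C a l = ?L @ ?s @ ?R"
      using M by (metis arc_add le_add_diff_inverse)
    have inner': "{w, w'} \<inter> src ` set (tl ?s) = {}"
    proof -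
      have "\<forall>j \<in> {Suc i..<i + m}. src (cyc j) \<notin> {w, w'}"
        using inner by (simp add: breakpoint_def)
      moreover have tl: "set (tl ?s) = cyc ` {Suc i..<i + m}"
        using m by (simp add: tl_arc set_arc)
      ultimately show ?thesis unfolding tl by auto
    qed
    have L: "src (hd ?s) \<in> {w, w'}" if "?L \<noteq> []"
    proof -
      have "side (cyc (i - 1)) = SideA" "0 < i" using that all_A[of "i - 1"] M m by auto
      then show ?thesis using m A breakpoint_Suc[of "i - 1"] by (simp add: hd_arc)
    qed
    have R: "src (hd ?R) \<in> {w, w'}" if "?R \<noteq> []"
    proof -
      have "side (cyc (i + m - 1)) = SideA" "side (cyc (i + m)) = SideA"
        using that all_A[of "i + m - 1"] all_A[of "i + m"] M m by auto
      then show ?thesis using that m breakpoint_Suc[of "i + m - 1"] by (simp add: hd_arc)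
    qed
    have "?s \<in> \<Union> (split_at w' ` split_at w (arc C a l))"
    proof (rule factor_in_split_twice[OF M_eq _ inner'])
      show "?s \<noteq> []" using m by simp
      show "count_list (map src (arc C a l)) w \<le> 1" "count_list (map src (arc C a l)) w' \<le> 1"
        using count_arc_le[OF M(4)] once by metis+
    qed (use L R in blast)+
    then show ?thesis using M(1) unfolding split_A_paths_eq by blast
  qed
  show ?thesis
  proof (cases "\<forall>e \<in> set C. side e = SideA")
    case True
    have "w \<in> set (map src C)" using once(1) by (metis count_list_0_iff zero_neq_one)
    then obtain a0 where "a0 < n" "src (C ! a0) = w" by (auto simp: in_set_conv_nth)
    then have "a0 \<le> i" "src (cyc a0) = w" using i by (auto simp: cyc_def)
    \<comment> \<open>The enclosing path is the full turn from the last visit of \<open>w\<close> up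
      to \<open>i\<close>; the next visit \<open>a + n\<close> is a breakpoint, so the stretch ends
      there at the latest.\<close>
    then obtain a where a: "a \<le> i" "src (cyc a) = w"
      and a_last: "\<And>b. a < b \<Longrightarrow> b \<le> i \<Longrightarrow> src (cyc b) \<noteq> w"
      using last_before[of a0 i "\<lambda>a. src (cyc a) = w"] by blast
    have "i < a + n" using a a_last[of "a + n"] n_pos by force
    moreover have "breakpoint (a + n)" using a by (simp add: breakpoint_def)
    ultimately have "i + m \<le> a + n" using inner[of "a + n"] by force
    moreover have "arc C a n \<in> base_paths"
      using True a n_pos by (auto simp: base_paths_def cyc_def intro!: exI[of _ "a mod n"] arc_mod[symmetric])
    ultimately show ?thesis using key a by blast
  next
    case False
    then obtain k0 where "k0 < n" "side (C ! k0) = SideB"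
      by (metis (full_types) in_set_conv_nth side.exhaust)
    then have k0: "k0 \<le> i" "side (cyc k0) = SideB" using i by (auto simp: cyc_def)
    \<comment> \<open>The enclosing path runs between the last B-edge \<open>k\<close> before
      \<open>i\<close> and the first B-edge \<open>r\<close> after it, where
      \<open>r \<le> k + n\<close> by periodicity.\<close>
    then obtain k where k: "k \<le> i" "side (cyc k) = SideB"
      and k_last: "\<And>b. k < b \<Longrightarrow> b \<le> i \<Longrightarrow> side (cyc b) \<noteq> SideB"
      using last_before[of k0 i "\<lambda>k. side (cyc k) = SideB"] by blast
    have "k < i" using k A by (cases "k = i") auto
    have "i < k + n" using k k_last[of "k + n"] n_pos by force
    define Q where "Q r \<longleftrightarrow> i < r \<and> side (cyc r) = SideB" for r
    define r where "r = Least Q"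
    have "Q (k + n)" using k \<open>i < k + n\<close> by (simp add: Q_def)
    then have "Q r" "r \<le> k + n" unfolding r_def by (rule LeastI, rule Least_le)
    then have r: "i < r" "side (cyc r) = SideB" "r \<le> k + n" by (simp_all add: Q_def)
    have r_least: "side (cyc b) \<noteq> SideB" if "i < b" "b < r" for b
    proof -
      have "\<not> Q b" using not_less_Least that(2) unfolding r_def by blast
      then show ?thesis using that(1) by (simp add: Q_def)
    qed
    have "i + m \<le> r" using A'[of r] r by force
    define l where "l = r - Suc k"
    have l: "Suc k + l = r" "1 \<le> l" "l \<le> n" using r \<open>k < i\<close> by (auto simp: l_def)
    have "side (cyc j) = SideA" if "Suc k \<le> j" "j < r" for j
      using that k_last[of j] r_least[of j] by (cases "j \<le> i") (auto intro: side.exhaust)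
    then have all_A: "\<forall>e \<in> set (arc C (Suc k mod n) l). side e = SideA"
      using l by (auto simp: arc_mod set_arc)
    have before: "side (C ! ((Suc k mod n + n - 1) mod n)) = SideB"
    proof -
      have "Suc k mod n + n - 1 = Suc k mod n + (n - 1)" "Suc k + (n - 1) = k + n"
        using n_pos by linarith+
      then have "(Suc k mod n + n - 1) mod n = k mod n"
        by (metis mod_add_left_eq mod_add_self2)
      then show ?thesis using k by (simp add: cyc_def)
    qed
    have after: "side (C ! ((Suc k mod n + l) mod n)) = SideB"
      using r l by (simp add: mod_add_left_eq cyc_def)
    have "arc C (Suc k mod n) l \<in> maximal_A_paths C"
      unfolding maximal_A_paths_def mem_Collect_eq
      by (intro exI[of _ "Suc k mod n"] exI[of _ l] conjI refl l mod_less_divisor n_pos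
          all_A before after)
    then have "arc C (Suc k) l \<in> base_paths" unfolding base_paths_def if_not_P[OF False] arc_mod .
    then show ?thesis using key[of "Suc k" l] l \<open>k < i\<close> \<open>i + m \<le> r\<close> by simp
  qed
qed

text \<open>Any arc between breakpoints is a concatenation of B-edges and split A-paths. Positions
  only grow, so \<open>n \<le> i\<close> persists.\<close>

lemma breakpoint_induct [consumes 3, case_names empty B_edge A_path]:
  assumes "breakpoint i" "breakpoint (i + l)" "n \<le> i"
    and empty: "\<And>i. P i 0"
    and B_edge: "\<And>i l. side (cyc i) = SideB \<Longrightarrow> P (Suc i) l \<Longrightarrow> P i (Suc l)"
    and A_path: "\<And>i m l. 0 < m \<Longrightarrow> arc C i m \<in> split_A_paths w w' C \<Longrightarrow> P (i + m) l \<Longrightarrow> P i (m + l)"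
  shows "P i l"
  using assms(1-3)
proof (induction l arbitrary: i rule: less_induct)
  case (less l)
  show ?case
  proof (cases l)
    case 0
    then show ?thesis using empty by simp
  next
    case (Suc l')
    show ?thesis
    proof (cases "side (cyc i)")
      case SideB
      then have "breakpoint (Suc i)" by (simp add: breakpoint_Suc)
      then show ?thesis using less Suc SideB by (auto intro!: B_edge less.IH)
    next
      case SideA
      \<comment> \<open>Distance to the next breakpoint; it is at most \<open>l\<close> because
        \<open>i + l\<close> is a breakpoint.\<close>
      define m where "m = (LEAST m. 0 < m \<and> breakpoint (i + m))"
      have m: "0 < m" "breakpoint (i + m)" "m \<le> l"
        and m_least: "\<And>k. 0 < k \<Longrightarrow> k < m \<Longrightarrow> \<not> breakpoint (i + k)"
        using LeastI[of "\<lambda>m. 0 < m \<and> breakpoint (i + m)" l]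
          Least_le[of "\<lambda>m. 0 < m \<and> breakpoint (i + m)" l]
          not_less_Least[of _ "\<lambda>m. 0 < m \<and> breakpoint (i + m)"] less Suc
        by (auto simp: m_def)
      have "\<not> breakpoint j" if "i < j" "j < i + m" for j
        using m_least[of "j - i"] that by simp
      then have "arc C i m \<in> split_A_paths w w' C"
        using breakpoint_gap_in_split_A_paths[of i m] less SideA m by simp
      moreover have "P (i + m) (l - m)" using less m by (intro less.IH) auto
      ultimately show ?thesis using A_path[of m i "l - m"] m by simp
    qed
  qed
qed

lemma sum_slack_arc:
  fixes val :: "'w \<Rightarrow> int"
  shows "(\<Sum>j = i..<i + l. val (tgt (cyc j)) - val (src (cyc j)) + wt (cyc j))
    = val (src (cyc (i + l))) - val (src (cyc i)) + weight (arc C i l)"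
  by (induction l) (simp_all add: tgt_cyc arc_eq weight_def)

end

section \<open>Entailment from A, inconsistency with B, and the shared variables\<close>

theorem mainTheorem9:
  fixes A B :: "'v lin set"
    and C p :: "'v dlvar edge list"
    and x :: 'v
  assumes "finite A" and "finite B"
    and "\<forall>c \<in> A \<union> B. is_utvpi c"
    and "\<exists>\<sigma> :: 'v \<Rightarrow> rat. models \<sigma> (A \<union> B)"
    and "\<not> (\<exists>\<sigma> :: 'v \<Rightarrow> int. models \<sigma> (A \<union> B))"
    and "is_cycle (constraint_graph (encoding A) (encoding B)) C"
    and "weight C = 0"
    and "count_list (map src C) (VPlus x) = 1"
    and "count_list (map src C) (VMinus x) = 1"
    and "is_path_along C (VMinus x) (VPlus x) p"
    and "odd (weight p)"
    and "x \<in> vars A \<inter> vars B"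
  shows "is_int_interpolant A B (upsilon ` summary ` split_A_paths (VPlus x) (VMinus x) C)"
proof -
  let ?G = "constraint_graph (encoding A) (encoding B)"
  let ?I = "split_A_paths (VPlus x) (VMinus x) C"
  interpret marked_cycle C "VPlus x" "VMinus x"
    using assms by unfold_locales (auto simp: is_cycle_def)
  have G: "cyc j \<in> ?G" for j using assms(6) cyc_in by (auto simp: is_cycle_def)
  have sum_slack: "(\<Sum>j = i..<i + l. slack \<sigma> (cyc j))
      = dl_val \<sigma> (src (cyc (i + l))) - dl_val \<sigma> (src (cyc i)) + weight (arc C i l)" for \<sigma> i l
    using sum_slack_arc[of "dl_val \<sigma>" i l] by (simp add: slack_def)
  \<comment> \<open>Read from right to left this gives the entailment from \<open>A\<close>; read
    from left to right it bounds the A-paths in the refutation.\<close>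
  have holds_summary: "holds \<sigma> (upsilon (summary (arc C i l))) \<longleftrightarrow> 0 \<le> (\<Sum>j = i..<i + l. slack \<sigma> (cyc j))"
    if "0 < l" for \<sigma> i l
    using that by (simp add: summary_def holds_upsilon sum_slack tgt_last_arc hd_arc del: upsilon.simps)
  have "models \<sigma> (upsilon ` summary ` ?I)" if "models \<sigma> A" for \<sigma> :: "'v \<Rightarrow> int"
    unfolding models_def
  proof safe
    fix s assume "s \<in> ?I"
    then obtain i l where s: "s = arc C i l" "0 < l" "\<forall>e \<in> set s. side e = SideA"
      using split_A_pathsE by metis
    have "0 \<le> slack \<sigma> (cyc j)" if "i \<le> j" "j < i + l" for j
      using graph_edge_sound[OF assms(3) G] s that \<open>models \<sigma> A\<close> by (simp add: set_arc)
    then show "holds \<sigma> (upsilon (summary s))"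
      using s by (auto simp: holds_summary intro: sum_nonneg)
  qed
  moreover have "\<not> models \<sigma> (upsilon ` summary ` ?I \<union> B)" for \<sigma> :: "'v \<Rightarrow> int"
  proof
    assume \<sigma>: "models \<sigma> (upsilon ` summary ` ?I \<union> B)"
    have nonneg: "0 \<le> (\<Sum>j = i..<i + l. slack \<sigma> (cyc j))"
      if "breakpoint i" "breakpoint (i + l)" "n \<le> i" for i l
      using that
    proof (induction rule: breakpoint_induct)
      case (B_edge i l)
      then have "0 \<le> slack \<sigma> (cyc i)"
        using graph_edge_sound[OF assms(3) G] \<sigma> by (simp add: models_def)
      then show ?case using B_edge by (simp add: sum.atLeast_Suc_lessThan del: sum.op_ivl_Suc)
    next
      case (A_path i m l)
      then have "0 \<le> (\<Sum>j = i..<i + m. slack \<sigma> (cyc j))"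
        using \<sigma> holds_summary[of m \<sigma> i] by (simp add: models_def)
      then show ?case
        using A_path sum.atLeastLessThan_concat[of i "i + m" "i + m + l" "\<lambda>j. slack \<sigma> (cyc j)"]
        by (simp add: add.assoc)
    qed simp
    obtain i0 l where p0: "i0 < n" "1 \<le> l" "l \<le> n" "p = arc C i0 l"
      "src (hd p) = VMinus x" "tgt (last p) = VPlus x"
      using assms(10) by (auto simp: is_path_along_def)
    \<comment> \<open>Shifting by one turn changes no edge and meets the bound
      \<open>n \<le> i\<close>.\<close>
    define i where "i = i0 + n"
    have p: "p = arc C i l" using arc_mod[of i l] arc_mod[of i0 l] p0 by (simp add: i_def)
    then have ends: "src (cyc i) = VMinus x" "src (cyc (i + l)) = VPlus x"
      using p0 hd_arc[of l i] tgt_last_arc[of l i] by auto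
    then have bp: "breakpoint i" "breakpoint (i + l)" by (simp_all add: breakpoint_def)
    \<comment> \<open>The complementary arc leads from \<open>VPlus x\<close> at
      \<open>i + l\<close> back to \<open>VMinus x\<close> at \<open>i + n\<close>.\<close>
    have closing: "i + l + (n - l) = i + n" using p0 by simp
    have "weight p + weight (arc C (i + l) (n - l)) = 0"
      using weight_arc_full[of i] arc_add[of i l "n - l"] p p0 assms(7) by simp
    moreover have "0 \<le> 2 * \<sigma> x + weight p"
      using nonneg[OF bp] p ends by (simp add: sum_slack i_def)
    moreover have "0 \<le> - 2 * \<sigma> x + weight (arc C (i + l) (n - l))"
      using nonneg[of "i + l" "n - l"] bp ends sum_slack[of \<sigma> "i + l" "n - l"]
      unfolding closing by (simp add: i_def)
    \<comment> \<open>The two lower bounds add up to the total weight 0, so both are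
      equalities.\<close>
    ultimately have "weight p = 2 * (- \<sigma> x)" by simp
    then show False using assms(11) by simp
  qed
  moreover have "vars (upsilon ` summary ` ?I) \<subseteq> vars A \<inter> vars B"
  proof
    fix y assume "y \<in> vars (upsilon ` summary ` ?I)"
    then obtain s where s: "s \<in> ?I" "y \<in> lin_vars (upsilon (summary s))" by (auto simp: vars_def)
    obtain i l where il: "s = arc C i l" "0 < l" "breakpoint i" "breakpoint (i + l)"
      "\<forall>e \<in> set s. side e = SideA" using split_A_pathsE[OF s(1)] by metis
    \<comment> \<open>A breakpoint touches a B-edge or belongs to \<open>x\<close>, which is shared
      by assumption.\<close>
    have breakpoint_B: "dl_var (src (cyc j)) \<in> vars B" if "breakpoint j" for j
    proof -
      have "src (cyc j) = tgt (cyc (j + n - 1))" using n_pos by (simp add: tgt_cyc)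
      then show ?thesis
        using that assms(12) graph_edge_vars[OF G, of j] graph_edge_vars[OF G, of "j + n - 1"]
        by (auto simp: breakpoint_def)
    qed
    have "side (cyc i) = SideA" "side (cyc (i + l - 1)) = SideA"
      using il by (auto simp: set_arc)
    then have "dl_var (src (cyc i)) \<in> vars A" "dl_var (src (cyc (i + l))) \<in> vars A"
      using graph_edge_vars[OF G, of i] graph_edge_vars[OF G, of "i + l - 1"] il(2)
      by (auto simp: tgt_cyc)
    moreover have "y \<in> {dl_var (src (cyc (i + l))), dl_var (src (cyc i))}"
      using s(2) il by (simp add: summary_def lin_vars_upsilon tgt_last_arc hd_arc del: upsilon.simps)
    ultimately show "y \<in> vars A \<inter> vars B" using breakpoint_B il by auto
  qed
  ultimately show ?thesis
    using finite_split_A_paths by (auto simp: is_int_interpolant_def)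
qed

end
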